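(* For every $\theta\in\mathbb T^{N}$, where $N=|X\setminus A|$, $$\frac{4\,w_{\min}\,d_{\min}^2}{\pi^2}\,\mathrm{Lip}(\chi_\theta)^2\;\le\;\lambda(\theta)\;\le\; w_{\max}\,M\,d_{\max}^2\,\mathrm{Lip}(\chi_\theta)^2 .$$
   Context: Lipschitz seminorm: for a map $f:(M_1,\rho_1)\to(M_2,\rho_2)$ of metric spaces, $\mathrm{Lip}(f):=\sup_{\alpha\ne\beta}\rho_2(f(\alpha),f(\beta))/\rho_1(\alpha,\beta)\in[0,\infty]$. Setting: $(X,d)$ is a metric space and $A\subseteq X$ is nonempty with $X\setminus A=\{x_1,\dots,x_N\}$ finite, $N\ge1$. Write $d(x,A)=\inf_{a\in A}d(x,a)$ and $d_1(x,y):=\min\{d(x,y),\,d(x,A)+d(y,A)\}$. Let $X/A=\{[A],x_1,\dots,x_N\}$ be the quotient collapsing $A$ to the basepoint $[A]$, and let $\overline d_1$ be the function on $X/A$ induced by $d_1$; it is assumed to be a metric on $X/A$ (equivalently $d(x_j,A)>0$ for all $j$). Diagrams: $D(X,A)$ is the free commutative monoid on $X\setminus A$ (finite multisets of points of $X\setminus A$; the point $[A]$ is identified with $0$). For $\alpha,\beta\in D(X,A)$, $W_1(\alpha,\beta)$ is the infimum of $\sum_{i}\overline d_1(u_i,v_i)$ over all finite multisets $\{(u_i,v_i)\}_i$ of pairs in $(X/A)\times(X/A)$ such that $\sum_i u_i$ equals $\alpha$ and $\sum_i v_i$ equals $\beta$ modulo multiples of $[A]$. $K(X,A)$ is the Grothendieck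 group of $D(X,A)$, identified with the free abelian group $\mathbb Z^{N}$ with basis $e_1,\dots,e_N$, where $e_j$ is the class of $x_j$. It carries the translation-invariant metric $\rho(a-b,c-e):=W_1(a+e,c+b)$ for $a,b,c,e\in D(X,A)$. Characters and phases: $\mathbb T^{N}=\mathbb R^{N}/2\pi\mathbb Z^{N}$. For $\theta\in\mathbb T^N$, $\chi_\theta:K(X,A)\to S^1\subset\mathbb C$ is $\chi_\theta(\sum_j n_je_j)=\exp(i\sum_j n_j\theta_j)$. The phase function $\phi_\theta:X/A\to S^1$ is $\phi_\theta([A])=1$, $\phi_\theta(x_j)=e^{i\theta_j}$. $S^1$ carries the geodesic (shorter arc length) metric $\operatorname{dist}(e^{ia},e^{ib})=\inf_{k\in\mathbb Z}|a-b+2\pi k|$. $\mathrm{Lip}(\chi_\theta)$ is taken with respect to $\rho$ and $\operatorname{dist}$. Graph model: fix a connected (simple, undirected) graph $H=(V,E)$ with $V=X/A$ such that, when each edge $\{u,v\}$ is given length $\overline d_1(u,v)$, the shortest-path metric of $H$ is $\overline d_1$. Fix symmetric conductances $w_{uv}=w_{vu}>0$ for $\{u,v\}\in E$ (not necessarily equal to the lengths), with $w_{uv}=0$ if $\{u,v\}\notin E$. The Dirichlet energy is $$\lambda(\theta):=\tfrac12\sum_{u,v\in V}w_{uv}\,|\phi_\theta(u)-\phi_\theta(v)|^2,$$ with $|\cdot|$ the complex modulus. Put $M=|E|$, $w_{\min}=\min_{\{u,v\}\in E}w_{uv}$, $w_{\max}=\max_{\{u,v\}\in E}w_{uv}$,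 $d_{\min}=\min_{\{u,v\}\in E}\overline d_1(u,v)$, $d_{\max}=\max_{\{u,v\}\in E}\overline d_1(u,v)$. *)

theory Defs
  imports "HOL-Analysis.Analysis" "HOL-Library.Multiset" "HOL-Library.Poly_Mapping"
begin

section \<open>Lipschitz seminorm and the circle\<close>

definition Lip :: "'a set \<Rightarrow> ('a \<Rightarrow> 'a \<Rightarrow> real) \<Rightarrow> ('b \<Rightarrow> 'b \<Rightarrow> real) \<Rightarrow> ('a \<Rightarrow> 'b) \<Rightarrow> ennreal" where
  "Lip S \<rho>1 \<rho>2 f =
     (SUP (\<alpha>, \<beta>) \<in> {(\<alpha>, \<beta>). \<alpha> \<in> S \<and> \<beta> \<in> S \<and> \<alpha> \<noteq> \<beta>}.
        ennreal (\<rho>2 (f \<alpha>) (f \<beta>)) / ennreal (\<rho>1 \<alpha> \<beta>))"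

text \<open>The geodesic metric of the unit circle; the value does not depend on the choice of the
  arguments, see \<open>circ_dist_cis\<close>.\<close>

definition circ_dist :: "complex \<Rightarrow> complex \<Rightarrow> real" where
  "circ_dist z w = (INF k::int. \<bar>Arg z - Arg w + 2 * pi * of_int k\<bar>)"

lemma circ_dist_cis: "circ_dist (cis a) (cis b) = (INF k::int. \<bar>a - b + 2 * pi * of_int k\<bar>)"
proof -
  have ex: "\<exists>n::int. Arg (cis t) = t + 2 * pi * of_int n" for t
  proof -
    have "cis (Arg (cis t)) = cis t"
      by (simp add: cis_Arg_unique cis_Arg sgn_div_norm)
    then have "sin (Arg (cis t)) = sin t \<and> cos (Arg (cis t)) = cos t"
      by (simp add: complex_eq_iff)
    then show ?thesis
      using sin_cos_eq_iff by blast
  qed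
  obtain m n :: int where mn: "Arg (cis a) = a + 2 * pi * of_int m" "Arg (cis b) = b + 2 * pi * of_int n"
    using ex by metis
  have "(\<lambda>k::int. \<bar>Arg (cis a) - Arg (cis b) + 2 * pi * of_int k\<bar>) =
        (\<lambda>k. \<bar>a - b + 2 * pi * of_int k\<bar>) \<circ> (\<lambda>k. k + (m - n))"
    by (auto simp: mn algebra_simps)
  moreover have "range (\<lambda>k::int. k + (m - n)) = UNIV"
    by (rule surjI[where f = "\<lambda>k. k - (m - n)"]) simp
  ultimately show ?thesis
    by (simp only: circ_dist_def image_comp[symmetric])
qed

section \<open>The quotient of a metric space by a subset\<close>

text \<open>The ambient space is the universe of a type of class \<open>metric_space\<close>. In \<open>'a option\<close> the point
  \<open>None\<close> stands for the basepoint \<open>[A]\<close> and \<open>Some x\<close>, for \<open>x\<close> outside \<open>A\<close>, for the point \<open>x\<close>.\<close>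

definition quot :: "'a set \<Rightarrow> 'a option set" where
  "quot A = insert None (Some ` (- A))"

definition d1 :: "'a::metric_space set \<Rightarrow> 'a \<Rightarrow> 'a \<Rightarrow> real" where
  "d1 A x y = min (dist x y) (infdist x A + infdist y A)"

definition proj :: "'a set \<Rightarrow> 'a \<Rightarrow> 'a option" where
  "proj A x = (if x \<in> A then None else Some x)"

definition rep :: "'a set \<Rightarrow> 'a option \<Rightarrow> 'a" where
  "rep A p = (case p of None \<Rightarrow> SOME a. a \<in> A | Some x \<Rightarrow> x)"

definition dbar :: "'a::metric_space set \<Rightarrow> 'a option \<Rightarrow> 'a option \<Rightarrow> real" where
  "dbar A p q = d1 A (rep A p) (rep A q)"

text \<open>\<open>dbar A\<close> is the function induced by \<open>d1 A\<close>: independence of representatives.\<close>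

lemma dbar_proj:
  assumes "A \<noteq> {}"
  shows "dbar A (proj A x) (proj A y) = d1 A x y"
proof -
  have d1: "d1 A x y = (if x \<in> A then infdist y A else if y \<in> A then infdist x A
      else min (dist x y) (infdist x A + infdist y A))" for x y
    using infdist_le[of x A y] infdist_le[of y A x]
    by (auto simp: d1_def dist_commute infdist_nonneg min_def)
  have "(SOME a. a \<in> A) \<in> A"
    using assms by (simp add: some_in_eq)
  then show ?thesis
    by (simp add: dbar_def proj_def rep_def d1)
qed

section \<open>Diagrams and the Wasserstein distance\<close>

definition diagrams :: "'a set \<Rightarrow> 'a multiset set" where
  "diagrams A = {\<alpha>. set_mset \<alpha> \<subseteq> - A}"

definition matching :: "'a set \<Rightarrow> 'a multiset \<Rightarrow> 'a multiset \<Rightarrow> ('a option \<times> 'a option) multiset \<Rightarrow> bool" where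
  "matching A \<alpha> \<beta> P \<longleftrightarrow> set_mset P \<subseteq> quot A \<times> quot A \<and>
     (\<exists>k. image_mset fst P = image_mset Some \<alpha> + replicate_mset k None) \<and>
     (\<exists>l. image_mset snd P = image_mset Some \<beta> + replicate_mset l None)"

definition cost :: "'a::metric_space set \<Rightarrow> ('a option \<times> 'a option) multiset \<Rightarrow> real" where
  "cost A P = (\<Sum>(u, v)\<in>#P. dbar A u v)"

definition W1 :: "'a::metric_space set \<Rightarrow> 'a multiset \<Rightarrow> 'a multiset \<Rightarrow> real" where
  "W1 A \<alpha> \<beta> = Inf {cost A P | P. matching A \<alpha> \<beta> P}"

lemma dbar_nonneg: "0 \<le> dbar A p q"
  by (simp add: dbar_def d1_def infdist_nonneg)

lemma cost_nonneg: "0 \<le> cost A P"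
  by (induction P) (auto simp: cost_def dbar_nonneg)

lemma W1_le_cost: "matching A \<alpha> \<beta> P \<Longrightarrow> W1 A \<alpha> \<beta> \<le> cost A P"
  unfolding W1_def by (rule cInf_lower) (auto intro!: bdd_belowI[of _ 0] cost_nonneg)

lemma matching_exists:
  assumes "\<alpha> \<in> diagrams A" "\<beta> \<in> diagrams A"
  shows "\<exists>P. matching A \<alpha> \<beta> P"
proof
  show "matching A \<alpha> \<beta> (image_mset (\<lambda>x. (Some x, None)) \<alpha> + image_mset (\<lambda>x. (None, Some x)) \<beta>)"
    using assms unfolding matching_def diagrams_def quot_def
    by (auto simp: multiset.map_comp comp_def image_mset_const_eq)
qed

lemma le_W1:
  assumes "\<alpha> \<in> diagrams A" "\<beta> \<in> diagrams A" "\<And>P. matching A \<alpha> \<beta> P \<Longrightarrow> c \<le> cost A P"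
  shows "c \<le> W1 A \<alpha> \<beta>"
  unfolding W1_def using matching_exists[OF assms(1,2)] assms(3) by (intro cInf_greatest) auto

lemma W1_add_cancel_single:
  assumes met: "Metric_space (quot A) (dbar A)"
    and D: "\<alpha> \<in> diagrams A" "\<beta> \<in> diagrams A" and z: "z \<notin> A"
  shows "W1 A (add_mset z \<alpha>) (add_mset z \<beta>) = W1 A \<alpha> \<beta>"
proof (rule antisym)
  interpret Metric_space "quot A" "dbar A" by (fact met)
  have zq: "Some z \<in> quot A" using z by (simp add: quot_def)
  have zz: "dbar A (Some z) (Some z) = 0" using zq by simp
  have D': "add_mset z \<alpha> \<in> diagrams A" "add_mset z \<beta> \<in> diagrams A"
    using D z by (auto simp: diagrams_def)
  show "W1 A (add_mset z \<alpha>) (add_mset z \<beta>) \<le> W1 A \<alpha> \<beta>"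
  proof (rule le_W1[OF D])
    fix P assume "matching A \<alpha> \<beta> P"
    then have "matching A (add_mset z \<alpha>) (add_mset z \<beta>) (add_mset (Some z, Some z) P)"
      using zq by (auto simp: matching_def)
    from W1_le_cost[OF this] show "W1 A (add_mset z \<alpha>) (add_mset z \<beta>) \<le> cost A P"
      by (simp add: cost_def zz)
  qed
  show "W1 A \<alpha> \<beta> \<le> W1 A (add_mset z \<alpha>) (add_mset z \<beta>)"
  proof (rule le_W1[OF D'])
    fix P assume P: "matching A (add_mset z \<alpha>) (add_mset z \<beta>) P"
    then obtain k l where kl: "image_mset fst P = add_mset (Some z) (image_mset Some \<alpha> + replicate_mset k None)"
      "image_mset snd P = add_mset (Some z) (image_mset Some \<beta> + replicate_mset l None)"
      and sub: "set_mset P \<subseteq> quot A \<times> quot A"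
      by (auto simp: matching_def)
    have "Some z \<in># image_mset fst P" by (simp add: kl)
    then obtain v where "(Some z, v) \<in># P" by auto
    then obtain P' where P': "P = add_mset (Some z, v) P'" by (metis insert_DiffM)
    have f: "image_mset fst P' = image_mset Some \<alpha> + replicate_mset k None"
      using kl(1) by (simp add: P')
    have vq: "v \<in> quot A" using sub by (simp add: P')
    show "W1 A \<alpha> \<beta> \<le> cost A P"
    proof (cases "v = Some z")
      case True
      then have "matching A \<alpha> \<beta> P'"
        using f kl(2) sub by (auto simp: P' matching_def)
      from W1_le_cost[OF this] show ?thesis
        by (simp add: cost_def P' True zz)
    next
      case False
      have "Some z \<in># add_mset v (image_mset snd P')" using kl(2) by (simp add: P')
      with False have "Some z \<in># image_mset snd P'" by simp
      then obtain u where "(u, Some z) \<in># P'" by auto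
      then obtain Q where Q: "P' = add_mset (u, Some z) Q" by (metis insert_DiffM)
      have uq: "u \<in> quot A" using sub by (simp add: P' Q)
      have "add_mset (Some z) (add_mset v (image_mset snd Q)) =
            add_mset (Some z) (image_mset Some \<beta> + replicate_mset l None)"
        using kl(2) by (simp add: P' Q add_mset_commute)
      then have "add_mset v (image_mset snd Q) = image_mset Some \<beta> + replicate_mset l None"
        by simp
      then have "matching A \<alpha> \<beta> (add_mset (u, v) Q)"
        using f sub by (auto simp: P' Q matching_def)
      from W1_le_cost[OF this] have "W1 A \<alpha> \<beta> \<le> dbar A u v + cost A Q"
        by (simp add: cost_def)
      also have "\<dots> \<le> dbar A u (Some z) + dbar A (Some z) v + cost A Q"
        using triangle[OF uq zq vq] by simp
      also have "\<dots> = cost A P" by (simp add: cost_def P' Q)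
      finally show ?thesis .
    qed
  qed
qed

lemma W1_add_cancel:
  assumes "Metric_space (quot A) (dbar A)"
    and "\<alpha> \<in> diagrams A" "\<beta> \<in> diagrams A" "\<gamma> \<in> diagrams A"
  shows "W1 A (\<alpha> + \<gamma>) (\<beta> + \<gamma>) = W1 A \<alpha> \<beta>"
  using assms(4)
proof (induction \<gamma>)
  case (add z \<gamma>)
  then have z: "z \<notin> A" and \<gamma>: "\<gamma> \<in> diagrams A" by (auto simp: diagrams_def)
  then have "\<alpha> + \<gamma> \<in> diagrams A" "\<beta> + \<gamma> \<in> diagrams A"
    using assms(2,3) by (auto simp: diagrams_def)
  from W1_add_cancel_single[OF assms(1) this z] add.IH[OF \<gamma>] show ?case by simp
qed simp

section \<open>The Grothendieck group\<close>

text \<open>The free abelian group on the points outside \<open>A\<close>; the basis element of \<open>x\<close> is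
  \<open>Poly_Mapping.single x 1\<close> and \<open>cls\<close> is the canonical map from diagrams. Every element is a
  difference of two classes (\<open>K_eq_differences\<close>), and the value of \<open>rho A\<close> does not depend on
  how the differences are written (\<open>rho_diff\<close>).\<close>

definition K :: "'a set \<Rightarrow> ('a \<Rightarrow>\<^sub>0 int) set" where
  "K A = {g. Poly_Mapping.keys g \<subseteq> - A}"

definition cls :: "'a multiset \<Rightarrow> 'a \<Rightarrow>\<^sub>0 int" where
  "cls \<alpha> = (\<Sum>x\<in>#\<alpha>. Poly_Mapping.single x 1)"

definition rho :: "'a::metric_space set \<Rightarrow> ('a \<Rightarrow>\<^sub>0 int) \<Rightarrow> ('a \<Rightarrow>\<^sub>0 int) \<Rightarrow> real" where
  "rho A g h = (THE r. \<forall>a\<in>diagrams A. \<forall>b\<in>diagrams A. \<forall>c\<in>diagrams A. \<forall>e\<in>diagrams A.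
     g = cls a - cls b \<and> h = cls c - cls e \<longrightarrow> r = W1 A (a + e) (c + b))"

lemma lookup_cls: "Poly_Mapping.lookup (cls \<alpha>) x = int (count \<alpha> x)"
  by (induction \<alpha>) (auto simp: cls_def lookup_add lookup_single when_def)

lemma cls_add: "cls (\<alpha> + \<beta>) = cls \<alpha> + cls \<beta>"
  by (simp add: cls_def)

lemma cls_inject: "cls \<alpha> = cls \<beta> \<longleftrightarrow> \<alpha> = \<beta>"
  by (metis lookup_cls multiset_eqI of_nat_eq_iff)

lemma K_eq_differences: "K A = {cls a - cls b | a b. a \<in> diagrams A \<and> b \<in> diagrams A}"
proof (intro set_eqI iffI)
  fix g assume g: "g \<in> K A"
  define a where "a = (\<Sum>x\<in>Poly_Mapping.keys g. replicate_mset (nat (Poly_Mapping.lookup g x)) x)"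
  define b where "b = (\<Sum>x\<in>Poly_Mapping.keys g. replicate_mset (nat (- Poly_Mapping.lookup g x)) x)"
  have ca: "count a x = nat (Poly_Mapping.lookup g x)" for x
    by (auto simp: a_def count_sum in_keys_iff)
  have cb: "count b x = nat (- Poly_Mapping.lookup g x)" for x
    by (auto simp: b_def count_sum in_keys_iff)
  have "g = cls a - cls b"
    by (rule poly_mapping_eqI) (simp add: lookup_minus lookup_cls ca cb)
  moreover have "a \<in> diagrams A" "b \<in> diagrams A"
    using g by (auto simp: K_def diagrams_def a_def b_def set_mset_sum split: if_splits)
  ultimately show "g \<in> {cls a - cls b | a b. a \<in> diagrams A \<and> b \<in> diagrams A}" by blast
next
  fix g assume "g \<in> {cls a - cls b | a b. a \<in> diagrams A \<and> b \<in> diagrams A}"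
  then obtain a b where g: "g = cls a - cls b" "a \<in> diagrams A" "b \<in> diagrams A" by blast
  show "g \<in> K A"
    unfolding K_def
  proof (clarsimp simp: in_keys_iff)
    fix x assume "Poly_Mapping.lookup g x \<noteq> 0" "x \<in> A"
    moreover have "count a x = 0" "count b x = 0"
      using g(2,3) \<open>x \<in> A\<close> by (auto simp: diagrams_def count_eq_zero_iff)
    ultimately show False by (simp add: g(1) lookup_minus lookup_cls)
  qed
qed

lemma rho_diff:
  assumes met: "Metric_space (quot A) (dbar A)"
    and D: "a \<in> diagrams A" "b \<in> diagrams A" "c \<in> diagrams A" "e \<in> diagrams A"
  shows "rho A (cls a - cls b) (cls c - cls e) = W1 A (a + e) (c + b)"
  unfolding rho_def
proof (rule the_equality)
  show "\<forall>a'\<in>diagrams A. \<forall>b'\<in>diagrams A. \<forall>c'\<in>diagrams A. \<forall>e'\<in>diagrams A.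
     cls a - cls b = cls a' - cls b' \<and> cls c - cls e = cls c' - cls e' \<longrightarrow>
     W1 A (a + e) (c + b) = W1 A (a' + e') (c' + b')"
  proof (intro ballI impI, elim conjE)
    fix a' b' c' e'
    assume D': "a' \<in> diagrams A" "b' \<in> diagrams A" "c' \<in> diagrams A" "e' \<in> diagrams A"
      and "cls a - cls b = cls a' - cls b'" "cls c - cls e = cls c' - cls e'"
    then have "cls (a + b') = cls (a' + b)" "cls (c + e') = cls (c' + e)"
      by (simp_all add: cls_add algebra_simps)
    then have eq: "a + b' = a' + b" "c + e' = c' + e"
      by (simp_all only: cls_inject)
    have add: "\<alpha> \<in> diagrams A \<Longrightarrow> \<beta> \<in> diagrams A \<Longrightarrow> \<alpha> + \<beta> \<in> diagrams A" for \<alpha> \<beta>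
      by (auto simp: diagrams_def)
    have "W1 A (a + e) (c + b) = W1 A ((a + e) + (b' + e')) ((c + b) + (b' + e'))"
      using D D' by (intro W1_add_cancel[OF met, symmetric] add)
    also have "(a + e) + (b' + e') = (a + b') + (e + e')"
      by (simp add: ac_simps)
    also have "(a + b') + (e + e') = (a' + e') + (b + e)"
      unfolding eq(1) by (simp add: ac_simps)
    also have "(c + b) + (b' + e') = (c + e') + (b + b')"
      by (simp add: ac_simps)
    also have "(c + e') + (b + b') = (c' + b') + (b + e)"
      unfolding eq(2) by (simp add: ac_simps)
    also have "W1 A ((a' + e') + (b + e)) ((c' + b') + (b + e)) = W1 A (a' + e') (c' + b')"
      using D D' by (intro W1_add_cancel[OF met] add)
    finally show "W1 A (a + e) (c + b) = W1 A (a' + e') (c' + b')" .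
  qed
next
  fix r
  assume "\<forall>a'\<in>diagrams A. \<forall>b'\<in>diagrams A. \<forall>c'\<in>diagrams A. \<forall>e'\<in>diagrams A.
     cls a - cls b = cls a' - cls b' \<and> cls c - cls e = cls c' - cls e' \<longrightarrow>
     r = W1 A (a' + e') (c' + b')"
  from this[rule_format, OF D] show "r = W1 A (a + e) (c + b)" by simp
qed

section \<open>Characters and phase functions\<close>

text \<open>A point of the torus is given by a representative \<open>\<theta> :: 'a \<Rightarrow> real\<close>, indexed by the points
  outside \<open>A\<close>; the values of \<open>\<theta>\<close> on \<open>A\<close> are never used. By periodicity of \<open>cis\<close>, both
  functions below depend on each \<open>\<theta> x\<close> only modulo \<open>2 * pi\<close>.\<close>

definition chi :: "'a set \<Rightarrow> ('a \<Rightarrow> real) \<Rightarrow> ('a \<Rightarrow>\<^sub>0 int) \<Rightarrow> complex" where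
  "chi A \<theta> g = cis (\<Sum>x\<in>- A. of_int (Poly_Mapping.lookup g x) * \<theta> x)"

definition phase :: "('a \<Rightarrow> real) \<Rightarrow> 'a option \<Rightarrow> complex" where
  "phase \<theta> p = (case p of None \<Rightarrow> 1 | Some x \<Rightarrow> cis (\<theta> x))"

section \<open>Finite simple graphs\<close>

definition simple_graph :: "'v set \<Rightarrow> 'v set set \<Rightarrow> bool" where
  "simple_graph V E \<longleftrightarrow> E \<subseteq> {{u, v} | u v. u \<in> V \<and> v \<in> V \<and> u \<noteq> v}"

text \<open>The infimum in \<open>shortest_path_dist\<close> is taken over walks; repeated vertices do not change it,
  because lengths are nonnegative.\<close>

definition walk :: "'v set \<Rightarrow> 'v set set \<Rightarrow> 'v \<Rightarrow> 'v list \<Rightarrow> 'v \<Rightarrow> bool" where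
  "walk V E u p v \<longleftrightarrow> p \<noteq> [] \<and> set p \<subseteq> V \<and> hd p = u \<and> last p = v \<and>
     successively (\<lambda>x y. {x, y} \<in> E) p"

definition connected_graph :: "'v set \<Rightarrow> 'v set set \<Rightarrow> bool" where
  "connected_graph V E \<longleftrightarrow> (\<forall>u\<in>V. \<forall>v\<in>V. \<exists>p. walk V E u p v)"

definition walk_length :: "('v \<Rightarrow> 'v \<Rightarrow> real) \<Rightarrow> 'v list \<Rightarrow> real" where
  "walk_length len p = (\<Sum>i<length p - 1. len (p ! i) (p ! Suc i))"

definition shortest_path_dist :: "'v set \<Rightarrow> 'v set set \<Rightarrow> ('v \<Rightarrow> 'v \<Rightarrow> real) \<Rightarrow> 'v \<Rightarrow> 'v \<Rightarrow> real" where
  "shortest_path_dist V E len u v = Inf {walk_length len p | p. walk V E u p v}"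

definition dirichlet :: "'a set \<Rightarrow> ('a option \<Rightarrow> 'a option \<Rightarrow> real) \<Rightarrow> ('a \<Rightarrow> real) \<Rightarrow> real" where
  "dirichlet A w \<theta> =
     1 / 2 * (\<Sum>u\<in>quot A. \<Sum>v\<in>quot A. w u v * (cmod (phase \<theta> u - phase \<theta> v))\<^sup>2)"

definition edge_min :: "'v set set \<Rightarrow> ('v \<Rightarrow> 'v \<Rightarrow> real) \<Rightarrow> real" where
  "edge_min E f = Min {f u v | u v. {u, v} \<in> E}"

definition edge_max :: "'v set set \<Rightarrow> ('v \<Rightarrow> 'v \<Rightarrow> real) \<Rightarrow> real" where
  "edge_max E f = Max {f u v | u v. {u, v} \<in> E}"

end

theory Submission
  imports Defs
begin

text \<open>The Lipschitz constant \<open>L\<close> of the character equals that of the phase function: every matching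
  bounds the arc between two character values by the sum of the arcs between the phases of its
  pairs, and conversely one-point diagrams are at \<open>W1\<close> distance at most \<open>dbar\<close>. Since \<open>dbar\<close> is a
  shortest-path metric, a bound on the edges suffices. On each edge the chord and the arc satisfy
  \<open>2 * arc / pi \<le> chord \<le> arc\<close>. The lower estimate holds because every single edge term is at most
  the energy; the upper one because each of the \<open>card E\<close> terms is at most the square of
  \<open>L * dbar\<close> times its conductance.\<close>

section \<open>Arcs and chords on the unit circle\<close>

text \<open>The distance from \<open>t\<close> to the lattice of multiples of \<open>2 * pi\<close>,
  written through the principal argument so that no infimum remains.\<close>

definition arc_norm :: "real \<Rightarrow> real" where
  "arc_norm t = \<bar>Arg (cis t)\<bar>"

lemma Arg_cis_shift: "\<exists>n::int. Arg (cis t) = t + 2 * pi * of_int n"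
proof -
  have "cis (Arg (cis t)) = cis t"
    by (simp add: cis_Arg_unique cis_Arg sgn_div_norm)
  then have "sin (Arg (cis t)) = sin t \<and> cos (Arg (cis t)) = cos t"
    by (simp add: complex_eq_iff)
  then show ?thesis
    using sin_cos_eq_iff by blast
qed

lemma arc_norm_nonneg: "0 \<le> arc_norm t"
  by (simp add: arc_norm_def)

lemma arc_norm_le_pi: "arc_norm t \<le> pi"
  using Arg_bounded[of "cis t"] by (auto simp: arc_norm_def)

text \<open>Two distinct representatives of an angle are at least \<open>2 * pi\<close> apart, and
  the principal one has modulus at most \<open>pi\<close>; hence any other has modulus at least
  \<open>pi\<close>.\<close>

lemma arc_norm_le_shift: "arc_norm t \<le> \<bar>t + 2 * pi * of_int k\<bar>"
proof -
  obtain n :: int where n: "Arg (cis t) = t + 2 * pi * of_int n"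
    using Arg_cis_shift by blast
  show ?thesis
  proof (cases "k = n")
    case False
    then have "1 \<le> \<bar>real_of_int (k - n)\<bar>"
      by linarith
    then have "2 * pi * 1 \<le> 2 * pi * \<bar>real_of_int (k - n)\<bar>"
      by (intro mult_left_mono) auto
    also have "\<dots> = \<bar>(t + 2 * pi * of_int k) - Arg (cis t)\<bar>"
      by (simp add: n abs_mult flip: right_diff_distrib)
    also have "\<dots> \<le> \<bar>t + 2 * pi * of_int k\<bar> + arc_norm t"
      unfolding arc_norm_def by (rule abs_triangle_ineq4)
    finally show ?thesis
      using arc_norm_le_pi[of t] by simp
  qed (simp add: arc_norm_def n)
qed

lemma arc_norm_le_abs: "arc_norm t \<le> \<bar>t\<bar>"
  using arc_norm_le_shift[of t 0] by simp

text \<open>The infimum over the shifts is attained at the one that produces the principal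
  argument.\<close>

lemma circ_dist_cis_arc: "circ_dist (cis a) (cis b) = arc_norm (a - b)"
  unfolding circ_dist_cis
proof (rule antisym)
  obtain n :: int where "Arg (cis (a - b)) = a - b + 2 * pi * of_int n"
    using Arg_cis_shift by blast
  then show "(INF k::int. \<bar>a - b + 2 * pi * of_int k\<bar>) \<le> arc_norm (a - b)"
    by (intro cINF_lower2[where x = n]) (auto simp: arc_norm_def intro!: bdd_belowI[of _ 0])
qed (auto intro!: cINF_greatest arc_norm_le_shift)

lemma arc_norm_zero [simp]: "arc_norm 0 = 0"
  using arc_norm_le_abs[of 0] arc_norm_nonneg[of 0] by simp

text \<open>Replacing \<open>s\<close> and \<open>t\<close> by their principal arguments leaves
  \<open>cis (s + t)\<close> unchanged, and the arc of a sum is at most its absolute value.\<close>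

lemma arc_norm_add: "arc_norm (s + t) \<le> arc_norm s + arc_norm t"
proof -
  have "cis (Arg (cis x)) = cis x" for x
    by (simp add: cis_Arg sgn_div_norm)
  then have "cis (s + t) = cis (Arg (cis s) + Arg (cis t))"
    by (metis cis_mult)
  then have "arc_norm (s + t) = arc_norm (Arg (cis s) + Arg (cis t))"
    by (simp add: arc_norm_def)
  also have "\<dots> \<le> \<bar>Arg (cis s) + Arg (cis t)\<bar>"
    by (rule arc_norm_le_abs)
  finally show ?thesis
    unfolding arc_norm_def by linarith
qed

lemma arc_norm_sum_mset: "arc_norm (\<Sum>i\<in>#P. f i) \<le> (\<Sum>i\<in>#P. arc_norm (f i))"
proof (induction P)
  case (add x P)
  then show ?case
    using arc_norm_add[of "f x" "\<Sum>i\<in>#P. f i"] by simp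
qed simp

text \<open>Jordan's inequality: sine is concave on \<open>{0..pi}\<close>, so its graph lies above
  the segment joining its points at \<open>0\<close> and \<open>pi / 2\<close>.\<close>

lemma jordan_sin:
  assumes "0 \<le> x" "x \<le> pi / 2"
  shows "2 * x / pi \<le> sin x"
proof -
  have "concave_on {0..pi} sin"
    unfolding concave_on_def
    by (rule f''_ge0_imp_convex[where f' = "\<lambda>x. - cos x" and f'' = sin])
       (auto intro!: derivative_eq_intros sin_ge_zero)
  then have "(1 - 2 * x / pi) * sin 0 + 2 * x / pi * sin (pi / 2)
      \<le> sin ((1 - 2 * x / pi) *\<^sub>R 0 + (2 * x / pi) *\<^sub>R (pi / 2))"
    using assms by (intro concave_onD) (auto simp: field_simps)
  then show ?thesis
    by simp
qed

lemma chord_eq_arc: "cmod (cis a - cis b) = 2 * sin (arc_norm (a - b) / 2)"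
proof -
  define t where "t = Arg (cis (a - b))"
  have t: "cis (a - b) = cis t"
    by (simp add: t_def cis_Arg sgn_div_norm)
  have half: "(sin (t / 2))\<^sup>2 = (1 - cos t) / 2"
    using cos_double_sin[of "t / 2"] by simp
  have "cis a - cis b = cis b * (cis t - 1)"
    by (simp add: algebra_simps cis_mult flip: t)
  then have "(cmod (cis a - cis b))\<^sup>2 = (cos t - 1)\<^sup>2 + (sin t)\<^sup>2"
    by (simp add: norm_mult cmod_power2)
  also have "\<dots> = 2 - 2 * cos t"
    using sin_cos_squared_add[of t] by (simp add: power2_eq_square algebra_simps)
  also have "\<dots> = (2 * sin (t / 2))\<^sup>2"
    by (simp add: power_mult_distrib half)
  also have "\<dots> = (2 * sin (\<bar>t\<bar> / 2))\<^sup>2"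
    by (auto simp: abs_if)
  finally have sq: "(cmod (cis a - cis b))\<^sup>2 = (2 * sin (arc_norm (a - b) / 2))\<^sup>2"
    by (simp add: arc_norm_def t_def)
  have "0 \<le> sin (arc_norm (a - b) / 2)"
    using arc_norm_nonneg[of "a - b"] arc_norm_le_pi[of "a - b"] by (intro sin_ge_zero) auto
  then show ?thesis
    by (intro power2_eq_imp_eq[OF sq]) simp_all
qed

lemma chord_le_arc: "cmod (cis a - cis b) \<le> arc_norm (a - b)"
  using sin_x_le_x[of "arc_norm (a - b) / 2"] arc_norm_nonneg[of "a - b"] by (simp add: chord_eq_arc)

text \<open>Jordan's inequality at half the arc; squaring this bound produces the factor
  \<open>4 / pi\<^sup>2\<close> of the lower estimate.\<close>

lemma arc_le_chord: "2 * arc_norm (a - b) / pi \<le> cmod (cis a - cis b)"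
  using jordan_sin[of "arc_norm (a - b) / 2"] arc_norm_nonneg[of "a - b"] arc_norm_le_pi[of "a - b"]
  by (simp add: chord_eq_arc)

section \<open>Angles of diagrams and the values of characters\<close>

text \<open>A real lift of \<open>phase \<theta>\<close> with the basepoint at angle 0, so that the
  copies of \<open>None\<close> in a matching add nothing to a sum of angles.\<close>

definition angle :: "('a \<Rightarrow> real) \<Rightarrow> 'a option \<Rightarrow> real" where
  "angle \<theta> p = (case p of None \<Rightarrow> 0 | Some x \<Rightarrow> \<theta> x)"

lemma phase_eq_cis: "phase \<theta> p = cis (angle \<theta> p)"
  by (simp add: phase_def angle_def split: option.split)

lemma sum_mset_angle:
  "(\<Sum>p\<in>#image_mset Some \<alpha> + replicate_mset k None. angle \<theta> p) = (\<Sum>x\<in>#\<alpha>. \<theta> x)"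
  by (simp add: multiset.map_comp comp_def angle_def)

lemma sum_count_diagram:
  fixes \<theta> :: "'a \<Rightarrow> real"
  assumes "finite (- A)" "\<alpha> \<in> diagrams A"
  shows "(\<Sum>x\<in>- A. real (count \<alpha> x) * \<theta> x) = (\<Sum>x\<in>#\<alpha>. \<theta> x)"
  using assms(2)
proof (induction \<alpha>)
  case (add y \<alpha>)
  then have "y \<in> - A" "\<alpha> \<in> diagrams A"
    by (auto simp: diagrams_def)
  moreover have "(\<Sum>x\<in>- A. real (count (add_mset y \<alpha>) x) * \<theta> x)
      = (\<Sum>x\<in>- A. (if x = y then \<theta> y else 0) + real (count \<alpha> x) * \<theta> x)"
    by (intro sum.cong) (auto simp: algebra_simps)
  ultimately show ?case
    using add.IH assms(1) by (simp add: sum.distrib)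
qed simp

lemma chi_diff:
  assumes "finite (- A)" "a \<in> diagrams A" "b \<in> diagrams A"
  shows "chi A \<theta> (cls a - cls b) = cis ((\<Sum>x\<in>#a. \<theta> x) - (\<Sum>x\<in>#b. \<theta> x))"
  by (simp add: chi_def lookup_minus lookup_cls left_diff_distrib sum_subtractf
      sum_count_diagram[OF assms(1) assms(2), symmetric] sum_count_diagram[OF assms(1) assms(3), symmetric])

section \<open>From edge bounds to the Lipschitz constant of the character, and back\<close>

text \<open>Passes a bound to the infimum over walks as well as to the infimum over matchings. The
  case \<open>c = 0\<close> is separate because the other one divides by \<open>c\<close>.\<close>

lemma le_mult_cInf:
  fixes S :: "real set"
  assumes "S \<noteq> {}" "0 \<le> c" "\<And>s. s \<in> S \<Longrightarrow> r \<le> c * s"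
  shows "r \<le> c * Inf S"
proof (cases "c = 0")
  case False
  with assms have "r / c \<le> Inf S"
    by (intro cInf_greatest) (auto simp: field_simps)
  with False assms(2) show ?thesis
    by (simp add: field_simps)
qed (use assms in auto)

lemma walk_length_Cons_Cons:
  "walk_length len (x # y # p) = len x y + walk_length len (y # p)"
  unfolding walk_length_def by (simp add: sum.lessThan_Suc_shift del: sum.lessThan_Suc)

text \<open>The difference of the end angles telescopes along the walk, and
  \<open>arc_norm_add\<close> bounds it one edge at a time.\<close>

lemma arc_le_walk_length:
  assumes "\<And>u v. {u, v} \<in> E \<Longrightarrow> arc_norm (f u - f v) \<le> c * len u v"
    and "walk V E u p v"
  shows "arc_norm (f u - f v) \<le> c * walk_length len p"
  using assms(2)
proof (induction p arbitrary: u)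
  case (Cons x p)
  show ?case
  proof (cases p)
    case Nil
    with Cons.prems show ?thesis
      by (auto simp: walk_def walk_length_def)
  next
    case (Cons y q)
    with Cons.prems have "{u, y} \<in> E" "walk V E y p v" "x = u"
      by (auto simp: walk_def)
    with Cons.IH assms(1) have "arc_norm (f u - f y) \<le> c * len u y" "arc_norm (f y - f v) \<le> c * walk_length len p"
      by blast+
    with arc_norm_add[of "f u - f y" "f y - f v"] show ?thesis
      by (simp add: Cons \<open>x = u\<close> walk_length_Cons_Cons distrib_left)
  qed
qed (simp add: walk_def)

lemma arc_le_shortest_path_dist:
  assumes "connected_graph V E" "u \<in> V" "v \<in> V" "0 \<le> c"
    and "\<And>u v. {u, v} \<in> E \<Longrightarrow> arc_norm (f u - f v) \<le> c * len u v"
  shows "arc_norm (f u - f v) \<le> c * shortest_path_dist V E len u v"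
  unfolding shortest_path_dist_def
proof (rule le_mult_cInf)
  show "{walk_length len p |p. walk V E u p v} \<noteq> {}"
    using assms(1-3) by (auto simp: connected_graph_def)
qed (use assms(4) arc_le_walk_length[OF assms(5)] in auto)

lemma sum_mset_subtractf:
  fixes f g :: "'b \<Rightarrow> 'c::ab_group_add"
  shows "(\<Sum>i\<in>#P. f i - g i) = (\<Sum>i\<in>#P. f i) - (\<Sum>i\<in>#P. g i)"
  by (induction P) (auto simp: algebra_simps)

lemma arc_le_W1:
  assumes D: "\<alpha> \<in> diagrams A" "\<beta> \<in> diagrams A" and c: "0 \<le> c"
    and edge: "\<And>u v. u \<in> quot A \<Longrightarrow> v \<in> quot A \<Longrightarrow> arc_norm (angle \<theta> u - angle \<theta> v) \<le> c * dbar A u v"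
  shows "arc_norm ((\<Sum>x\<in>#\<alpha>. \<theta> x) - (\<Sum>x\<in>#\<beta>. \<theta> x)) \<le> c * W1 A \<alpha> \<beta>"
  unfolding W1_def
proof (rule le_mult_cInf)
  show "{cost A P |P. matching A \<alpha> \<beta> P} \<noteq> {}"
    using matching_exists[OF D] by blast
next
  fix s assume "s \<in> {cost A P |P. matching A \<alpha> \<beta> P}"
  then obtain P where s: "s = cost A P" and P: "matching A \<alpha> \<beta> P"
    by blast
  obtain k l where "image_mset fst P = image_mset Some \<alpha> + replicate_mset k None"
    "image_mset snd P = image_mset Some \<beta> + replicate_mset l None"
    using P unfolding matching_def by blast
  \<comment> \<open>Both totals can be read off the coordinates of \<open>P\<close>, since the
    padding by \<open>None\<close> has angle 0; their difference then splits pair by pair.\<close>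
  then have "(\<Sum>x\<in>#\<alpha>. \<theta> x) = (\<Sum>q\<in>#image_mset fst P. angle \<theta> q)"
    "(\<Sum>x\<in>#\<beta>. \<theta> x) = (\<Sum>q\<in>#image_mset snd P. angle \<theta> q)"
    by (simp_all only: sum_mset_angle)
  then have "arc_norm ((\<Sum>x\<in>#\<alpha>. \<theta> x) - (\<Sum>x\<in>#\<beta>. \<theta> x)) = arc_norm (\<Sum>q\<in>#P. angle \<theta> (fst q) - angle \<theta> (snd q))"
    by (simp add: multiset.map_comp comp_def sum_mset_subtractf)
  also have "\<dots> \<le> (\<Sum>q\<in>#P. arc_norm (angle \<theta> (fst q) - angle \<theta> (snd q)))"
    by (rule arc_norm_sum_mset)
  also have "\<dots> \<le> (\<Sum>q\<in>#P. c * dbar A (fst q) (snd q))"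
    using P by (intro sum_mset_mono edge) (auto simp: matching_def)
  also have "\<dots> = c * s"
    by (simp add: s cost_def case_prod_beta sum_mset_distrib_left)
  finally show "arc_norm ((\<Sum>x\<in>#\<alpha>. \<theta> x) - (\<Sum>x\<in>#\<beta>. \<theta> x)) \<le> c * s" .
qed (fact c)

lemma Lip_chi_le:
  assumes met: "Metric_space (quot A) (dbar A)" and fin: "finite (- A)" and c: "0 \<le> c"
    and edge: "\<And>u v. u \<in> quot A \<Longrightarrow> v \<in> quot A \<Longrightarrow> arc_norm (angle \<theta> u - angle \<theta> v) \<le> c * dbar A u v"
  shows "Lip (K A) (rho A) circ_dist (chi A \<theta>) \<le> ennreal c"
  unfolding Lip_def
proof (rule SUP_least, clarify)
  fix g h assume "g \<in> K A" "h \<in> K A"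
  then obtain a b c' e where D: "a \<in> diagrams A" "b \<in> diagrams A" "c' \<in> diagrams A" "e \<in> diagrams A"
    and gh: "g = cls a - cls b" "h = cls c' - cls e"
    unfolding K_eq_differences by blast
  define r where "r = W1 A (a + e) (c' + b)"
  have add: "a + e \<in> diagrams A" "c' + b \<in> diagrams A"
    using D by (auto simp: diagrams_def)
  \<comment> \<open>The angles regroup into those of \<open>a + e\<close> and \<open>c' + b\<close>,
    the two diagrams whose \<open>W1\<close> distance is \<open>rho A g h\<close>.\<close>
  have "circ_dist (chi A \<theta> g) (chi A \<theta> h) = arc_norm ((\<Sum>x\<in>#a + e. \<theta> x) - (\<Sum>x\<in>#c' + b. \<theta> x))"
    unfolding gh chi_diff[OF fin D(1,2)] chi_diff[OF fin D(3,4)] circ_dist_cis_arc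
    by (simp add: algebra_simps)
  also have "\<dots> \<le> c * r"
    unfolding r_def using add c edge by (rule arc_le_W1)
  finally have "circ_dist (chi A \<theta> g) (chi A \<theta> h) \<le> c * r" .
  moreover have "0 \<le> r"
    unfolding r_def using add by (intro le_W1 cost_nonneg)
  ultimately have "ennreal (circ_dist (chi A \<theta> g) (chi A \<theta> h)) \<le> ennreal c * ennreal r"
    using c by (simp add: ennreal_leI flip: ennreal_mult)
  \<comment> \<open>For \<open>r = 0\<close> the preceding bound makes the numerator 0, and
    \<open>0 / 0 = 0\<close> in \<open>ennreal\<close>.\<close>
  then have "ennreal (circ_dist (chi A \<theta> g) (chi A \<theta> h)) / ennreal r \<le> ennreal c"
    by (cases "r = 0") (use \<open>0 \<le> r\<close> in \<open>auto intro: divide_le_posI_ennreal simp: mult.commute less_le\<close>)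
  then show "ennreal (circ_dist (chi A \<theta> g) (chi A \<theta> h)) / ennreal (rho A g h) \<le> ennreal c"
    using rho_diff[OF met D] by (simp add: gh r_def)
qed

text \<open>The classes of \<open>u\<close> and \<open>v\<close> form one of the pairs in the
  supremum that defines \<open>Lip\<close>, and matching \<open>u\<close> with \<open>v\<close>
  bounds their distance by \<open>dbar A u v\<close>.\<close>

lemma arc_le_Lip_chi:
  assumes met: "Metric_space (quot A) (dbar A)" and fin: "finite (- A)"
    and L: "0 \<le> L" "Lip (K A) (rho A) circ_dist (chi A \<theta>) \<le> ennreal L"
    and uv: "u \<in> quot A" "v \<in> quot A"
  shows "arc_norm (angle \<theta> u - angle \<theta> v) \<le> L * dbar A u v"
proof (cases "u = v")
  case True
  with L(1) show ?thesis
    by (simp add: dbar_nonneg)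
next
  case False
  \<comment> \<open>The diagram of a point of the quotient; the basepoint becomes the empty
    diagram.\<close>
  define pt where "pt p = (case p of None \<Rightarrow> {#} | Some x \<Rightarrow> {#x#})" for p :: "'a option"
  have D: "pt u \<in> diagrams A" "pt v \<in> diagrams A" "{#} \<in> diagrams A"
    using uv by (auto simp: pt_def diagrams_def quot_def split: option.splits)
  have angle: "(\<Sum>x\<in>#pt p. \<theta> x) = angle \<theta> p" for p
    by (simp add: pt_def angle_def split: option.split)
  have cls: "cls (pt p) = cls (pt p) - cls {#}" for p
    by (simp add: cls_def)
  have chi: "circ_dist (chi A \<theta> (cls (pt u))) (chi A \<theta> (cls (pt v))) = arc_norm (angle \<theta> u - angle \<theta> v)"
    using chi_diff[OF fin D(1,3), of \<theta>] chi_diff[OF fin D(2,3), of \<theta>]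
    by (simp add: circ_dist_cis_arc angle flip: cls)
  \<comment> \<open>\<open>k\<close> is 1 for the basepoint and 0 for every other point.\<close>
  have split: "\<exists>k. {#p#} = image_mset Some (pt p) + replicate_mset k None" for p :: "'a option"
    by (cases p) (auto simp: pt_def intro: exI[of _ 0] exI[of _ "1::nat"])
  have "rho A (cls (pt u)) (cls (pt v)) = W1 A (pt u) (pt v)"
    using rho_diff[OF met D(1,3,2,3)] by (simp flip: cls)
  also have "\<dots> \<le> cost A {#(u, v)#}"
    using uv split by (intro W1_le_cost) (auto simp: matching_def)
  finally have rho: "rho A (cls (pt u)) (cls (pt v)) \<le> dbar A u v"
    by (simp add: cost_def)
  have pos: "0 < dbar A u v"
    using False uv met dbar_nonneg[of A u v] by (simp add: Metric_space.zero less_le)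
  \<comment> \<open>A smaller denominator enlarges the quotient. If \<open>rho\<close> is not
    positive, its \<open>ennreal\<close> value is 0, and the right-hand side is infinite unless the
    arc vanishes, when both sides are 0.\<close>
  have "ennreal (arc_norm (angle \<theta> u - angle \<theta> v)) / ennreal (dbar A u v)
      \<le> ennreal (arc_norm (angle \<theta> u - angle \<theta> v)) / ennreal (rho A (cls (pt u)) (cls (pt v)))"
    using rho pos arc_norm_nonneg
    by (cases "rho A (cls (pt u)) (cls (pt v)) \<le> 0")
       (auto simp: ennreal_neg divide_ennreal intro!: ennreal_leI divide_left_mono)
  also have "\<dots> \<le> Lip (K A) (rho A) circ_dist (chi A \<theta>)"
  proof -
    have "cls (pt u) \<noteq> cls (pt v)"
      using False by (cases u; cases v) (auto simp: cls_inject pt_def)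
    moreover have "cls (pt u) \<in> K A" "cls (pt v) \<in> K A"
      using D cls unfolding K_eq_differences by blast+
    ultimately show ?thesis
      unfolding Lip_def by (intro SUP_upper2[of "(cls (pt u), cls (pt v))"]) (auto simp: chi)
  qed
  also note L(2)
  finally show ?thesis
    using pos L(1) arc_norm_nonneg by (simp add: divide_ennreal ennreal_le_iff pos_divide_le_eq)
qed

section \<open>Edges of a finite simple graph and the energy as a sum over them\<close>

lemma simple_graph_edge:
  assumes "simple_graph V E" "{u, v} \<in> E"
  shows "u \<in> V" "v \<in> V" "u \<noteq> v"
proof -
  from assms obtain a b where "{u, v} = {a, b}" "a \<in> V" "b \<in> V" "a \<noteq> b"
    unfolding simple_graph_def by blast
  then show "u \<in> V" "v \<in> V" "u \<noteq> v"
    by (auto simp: doubleton_eq_iff)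
qed

lemma finite_edge_pairs:
  assumes "finite V" "simple_graph V E"
  shows "finite {(u, v). {u, v} \<in> E}"
proof (rule finite_subset)
  show "{(u, v). {u, v} \<in> E} \<subseteq> V \<times> V"
    by (auto dest: simple_graph_edge(1,2)[OF assms(2)])
qed (simp add: assms(1))

lemma finite_edge_values:
  assumes "finite V" "simple_graph V E"
  shows "finite {f u v |u v. {u, v} \<in> E}"
proof -
  have "{f u v |u v. {u, v} \<in> E} = (\<lambda>(u, v). f u v) ` {(u, v). {u, v} \<in> E}"
    by auto
  with finite_edge_pairs[OF assms] show ?thesis
    by simp
qed

lemma edge_min_le:
  assumes "finite V" "simple_graph V E" "{u, v} \<in> E"
  shows "edge_min E f \<le> f u v"
  unfolding edge_min_def using finite_edge_values[OF assms(1,2)] assms(3) by (intro Min_le) auto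

lemma edge_max_ge:
  assumes "finite V" "simple_graph V E" "{u, v} \<in> E"
  shows "f u v \<le> edge_max E f"
  unfolding edge_max_def using finite_edge_values[OF assms(1,2)] assms(3) by (intro Max_ge) auto

lemma edge_min_pos:
  assumes "finite V" "simple_graph V E" "{a, b} \<in> E" "\<And>u v. {u, v} \<in> E \<Longrightarrow> 0 < f u v"
  shows "0 < edge_min E f"
proof -
  have "edge_min E f \<in> {f u v |u v. {u, v} \<in> E}"
    unfolding edge_min_def using finite_edge_values[OF assms(1,2)] assms(3) by (intro Min_in) auto
  with assms(4) show ?thesis
    by auto
qed

text \<open>An edge \<open>{a, b}\<close> comes from no ordered pairs other than
  \<open>(a, b)\<close> and \<open>(b, a)\<close>. The factor 2 cancels the \<open>1 / 2\<close> in
  the energy.\<close>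

lemma card_edge_pairs_le:
  assumes "finite V" "simple_graph V E"
  shows "card {(u, v). {u, v} \<in> E} \<le> 2 * card E"
proof -
  have "E \<subseteq> Pow V"
    using assms(2) unfolding simple_graph_def by blast
  then have finE: "finite E"
    by (rule finite_subset) (simp add: assms(1))
  have le: "finite {(u, v). {u, v} = e} \<and> card {(u, v). {u, v} = e} \<le> 2" if "e \<in> E" for e
  proof -
    from that assms(2) obtain a b where "e = {a, b}"
      unfolding simple_graph_def by blast
    then have sub: "{(u, v). {u, v} = e} \<subseteq> {(a, b), (b, a)}"
      by (auto simp: doubleton_eq_iff)
    have "card {(u, v). {u, v} = e} \<le> card {(a, b), (b, a)}"
      using sub by (intro card_mono) auto
    also have "\<dots> \<le> 2"
      by (simp add: card_insert_le_m1)
    finally show ?thesis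
      using finite_subset[OF sub] by simp
  qed
  have "{(u, v). {u, v} \<in> E} = (\<Union>e\<in>E. {(u, v). {u, v} = e})"
    by auto
  then have "card {(u, v). {u, v} \<in> E} \<le> (\<Sum>e\<in>E. card {(u, v). {u, v} = e})"
    using card_UN_le[OF finE, of "\<lambda>e. {(u, v). {u, v} = e}"] by simp
  also have "\<dots> \<le> (\<Sum>e\<in>E. 2)"
    using le by (intro sum_mono) blast
  finally show ?thesis
    by simp
qed

text \<open>A walk between distinct vertices has at least two entries, and the first two span an
  edge. The existence of an edge makes \<open>edge_min\<close> and \<open>edge_max\<close> extrema
  of nonempty sets.\<close>

lemma connected_graph_edge_exists:
  assumes "connected_graph V E" "u \<in> V" "v \<in> V" "u \<noteq> v"
  obtains a b where "{a, b} \<in> E"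
proof -
  obtain p where "walk V E u p v"
    using assms(1-3) by (auto simp: connected_graph_def)
  with \<open>u \<noteq> v\<close> that show thesis
    \<comment> \<open>This rule splits lists into empty, singleton and longer ones.\<close>
    by (cases p rule: remdups_adj.cases) (auto simp: walk_def)
qed

lemma dirichlet_eq_edge_sum:
  assumes "finite (- A)" "simple_graph (quot A) E"
    and "\<And>u v. u \<in> quot A \<Longrightarrow> v \<in> quot A \<Longrightarrow> {u, v} \<notin> E \<Longrightarrow> w u v = 0"
  shows "dirichlet A w \<theta> =
    1 / 2 * (\<Sum>(u, v)\<in>{(u, v). {u, v} \<in> E}. w u v * (cmod (phase \<theta> u - phase \<theta> v))\<^sup>2)"
proof -
  have fin: "finite (quot A)"
    using assms(1) by (simp add: quot_def)
  have "(\<Sum>(u, v)\<in>quot A \<times> quot A. w u v * (cmod (phase \<theta> u - phase \<theta> v))\<^sup>2)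
      = (\<Sum>(u, v)\<in>{(u, v). {u, v} \<in> E}. w u v * (cmod (phase \<theta> u - phase \<theta> v))\<^sup>2)"
  proof (rule sum.mono_neutral_right)
    show "{(u, v). {u, v} \<in> E} \<subseteq> quot A \<times> quot A"
      by (auto dest: simple_graph_edge(1,2)[OF assms(2)])
  qed (auto simp: fin, use assms(3) in blast)
  then show ?thesis
    by (simp add: dirichlet_def sum.cartesian_product)
qed

section \<open>Comparison of the energy with the squared Lipschitz constant\<close>

theorem lemma1p2:
  fixes A :: "'a::metric_space set"
    and E :: "'a option set set"
    and w :: "'a option \<Rightarrow> 'a option \<Rightarrow> real"
    and \<theta> :: "'a \<Rightarrow> real"
  assumes "A \<noteq> {}" and "finite (- A)" and "- A \<noteq> {}"
    and "Metric_space (quot A) (dbar A)"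
    and "simple_graph (quot A) E" and "connected_graph (quot A) E"
    and "\<And>u v. u \<in> quot A \<Longrightarrow> v \<in> quot A \<Longrightarrow>
           shortest_path_dist (quot A) E (dbar A) u v = dbar A u v"
    and "\<And>u v. u \<in> quot A \<Longrightarrow> v \<in> quot A \<Longrightarrow> w u v = w v u"
    and "\<And>u v. {u, v} \<in> E \<Longrightarrow> 0 < w u v"
    and "\<And>u v. u \<in> quot A \<Longrightarrow> v \<in> quot A \<Longrightarrow> {u, v} \<notin> E \<Longrightarrow> w u v = 0"
  shows "ennreal (4 * edge_min E w * (edge_min E (dbar A))\<^sup>2 / pi\<^sup>2)
             * (Lip (K A) (rho A) circ_dist (chi A \<theta>))\<^sup>2
           \<le> ennreal (dirichlet A w \<theta>)
         \<and> ennreal (dirichlet A w \<theta>)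
           \<le> ennreal (edge_max E w * real (card E) * (edge_max E (dbar A))\<^sup>2)
             * (Lip (K A) (rho A) circ_dist (chi A \<theta>))\<^sup>2"
proof -
  note fin = assms(2) and met = assms(4) and graph = assms(5) and conn = assms(6)
    and wpos = assms(9)
  have finV: "finite (quot A)"
    using fin by (simp add: quot_def)
  note edge_in = simple_graph_edge[OF graph]
  obtain x where "x \<in> - A"
    using assms(3) by blast
  then obtain a b where ab: "{a, b} \<in> E"
    using connected_graph_edge_exists[OF conn, of None "Some x"] by (auto simp: quot_def)
  define \<Lambda> where "\<Lambda> = Lip (K A) (rho A) circ_dist (chi A \<theta>)"
  define e where "e = dirichlet A w \<theta>"
  define S where "S = {(u, v). {u, v} \<in> E}"
  define F where "F = (\<lambda>(u, v). w u v * (cmod (phase \<theta> u - phase \<theta> v))\<^sup>2)"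
  define m where "m = edge_min E w"
  define d where "d = edge_min E (dbar A)"
  have e_sum: "e = 1 / 2 * sum F S"
    unfolding e_def S_def F_def using fin graph assms(10) by (rule dirichlet_eq_edge_sum)
  have finS: "finite S"
    unfolding S_def using finV graph by (rule finite_edge_pairs)
  have F_nonneg: "0 \<le> F q" if "q \<in> S" for q
    using that by (auto simp: F_def S_def intro!: mult_nonneg_nonneg less_imp_le[OF wpos])
  have e_nonneg: "0 \<le> e"
    by (simp add: e_sum sum_nonneg F_nonneg)
  have dbar_pos: "0 < dbar A u v" if "{u, v} \<in> E" for u v
    using edge_in[OF that] met dbar_nonneg[of A u v] by (simp add: Metric_space.zero less_le)
  have m: "0 < m" and d: "0 < d"
    unfolding m_def d_def using edge_min_pos[OF finV graph ab] wpos dbar_pos by blast+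
  \<comment> \<open>The Lipschitz constant for which the lower estimate becomes an equality.\<close>
  define c where "c = sqrt (e * pi\<^sup>2 / (4 * m * d\<^sup>2))"
  have c: "0 \<le> c"
    using e_nonneg m by (simp add: c_def)
  have c_sq: "4 * m * d\<^sup>2 / pi\<^sup>2 * c\<^sup>2 = e"
    using e_nonneg m d by (simp add: c_def)
  have edge_c: "arc_norm (angle \<theta> u - angle \<theta> v) \<le> c * dbar A u v" if uv: "{u, v} \<in> E" for u v
  proof -
    let ?t = "arc_norm (angle \<theta> u - angle \<theta> v)"
    \<comment> \<open>Both orientations of the edge occur in the sum with equal terms; together they
      offset the factor \<open>1 / 2\<close>, so one full edge term is at most
      \<open>e\<close>.\<close>
    have "{(u, v), (v, u)} \<subseteq> S"
      using uv by (auto simp: S_def insert_commute)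
    then have "sum F {(u, v), (v, u)} \<le> sum F S"
      using finS F_nonneg by (intro sum_mono2) auto
    moreover have "F (v, u) = F (u, v)"
      using edge_in[OF uv] assms(8) by (simp add: F_def norm_minus_commute)
    ultimately have "F (u, v) \<le> e"
      using edge_in[OF uv] by (simp add: e_sum)
    moreover have "m * (2 * ?t / pi)\<^sup>2 \<le> F (u, v)"
      unfolding F_def prod.case phase_eq_cis m_def
      using edge_min_le[OF finV graph uv, of w] wpos[OF uv] m arc_norm_nonneg
      by (intro mult_mono power_mono arc_le_chord) auto
    ultimately have "m * (2 * ?t / pi)\<^sup>2 \<le> e"
      by simp
    \<comment> \<open>Writing \<open>e\<close> through \<open>c_sq\<close> leaves the common factor
      \<open>4 * m / pi\<^sup>2\<close> on both sides.\<close>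
    then have "?t\<^sup>2 \<le> (c * d)\<^sup>2"
      using m by (simp add: field_simps flip: c_sq)
    then have "?t \<le> c * d"
      by (rule power2_le_imp_le) (use c d in simp)
    also have "\<dots> \<le> c * dbar A u v"
      unfolding d_def using edge_min_le[OF finV graph uv] c by (rule mult_left_mono)
    finally show ?thesis .
  qed
  have "arc_norm (angle \<theta> u - angle \<theta> v) \<le> c * dbar A u v" if "u \<in> quot A" "v \<in> quot A" for u v
    unfolding assms(7)[OF that, symmetric] using conn that c edge_c by (rule arc_le_shortest_path_dist)
  then have \<Lambda>_le: "\<Lambda> \<le> ennreal c"
    unfolding \<Lambda>_def using met fin c by (intro Lip_chi_le)
  \<comment> \<open>The finite bound \<open>c\<close> makes \<open>\<Lambda>\<close> a real number,
    and the rest is real arithmetic.\<close>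
  then obtain L where L: "0 \<le> L" "\<Lambda> = ennreal L"
    by (cases \<Lambda>) (auto simp: top_unique)
  have "L \<le> c"
    using \<Lambda>_le L c by simp
  \<comment> \<open>Equality holds at \<open>c\<close>, and the left-hand side increases with
    \<open>L\<close>.\<close>
  then have lower: "4 * m * d\<^sup>2 / pi\<^sup>2 * L\<^sup>2 \<le> e"
    using L m unfolding c_sq[symmetric] by (intro mult_left_mono power_mono) auto
  define W where "W = edge_max E w"
  define D where "D = edge_max E (dbar A)"
  have W: "0 < W"
    using wpos[OF ab] edge_max_ge[OF finV graph ab, of w] by (simp add: W_def)
  have F_le: "F q \<le> W * (L * D)\<^sup>2" if "q \<in> S" for q
  proof -
    obtain u v where q: "q = (u, v)"
      by force
    then have uv: "{u, v} \<in> E"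
      using that by (simp add: S_def)
    have "cmod (phase \<theta> u - phase \<theta> v) \<le> arc_norm (angle \<theta> u - angle \<theta> v)"
      unfolding phase_eq_cis by (rule chord_le_arc)
    also have "\<dots> \<le> L * dbar A u v"
      using arc_le_Lip_chi[OF met fin L(1)] L(2) edge_in[OF uv] by (simp add: \<Lambda>_def)
    also have "\<dots> \<le> L * D"
      unfolding D_def using edge_max_ge[OF finV graph uv] L(1) by (rule mult_left_mono)
    finally show ?thesis
      unfolding q F_def prod.case
      using edge_max_ge[OF finV graph uv, of w] W by (intro mult_mono power_mono) (auto simp: W_def)
  qed
  \<comment> \<open>Every ordered pair contributes at most the same constant, and there are at most
    \<open>2 * card E\<close> of them.\<close>
  have "sum F S \<le> of_nat (card S) * (W * (L * D)\<^sup>2)"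
    using F_le by (rule sum_bounded_above)
  also have "\<dots> \<le> real (2 * card E) * (W * (L * D)\<^sup>2)"
    unfolding S_def using card_edge_pairs_le[OF finV graph] W by (intro mult_right_mono) auto
  finally have upper: "e \<le> W * real (card E) * D\<^sup>2 * L\<^sup>2"
    by (simp add: e_sum power_mult_distrib mult_ac)
  have "ennreal (4 * m * d\<^sup>2 / pi\<^sup>2) * \<Lambda>\<^sup>2 \<le> ennreal e"
    using ennreal_leI[OF lower] L m by (simp add: ennreal_power flip: ennreal_mult)
  moreover have "ennreal e \<le> ennreal (W * real (card E) * D\<^sup>2) * \<Lambda>\<^sup>2"
    using ennreal_leI[OF upper] L W by (simp add: ennreal_power flip: ennreal_mult)
  ultimately show ?thesis
    unfolding \<Lambda>_def e_def m_def d_def W_def D_def by (rule conjI)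
qed

end
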